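(* Let $f$ be a generator on $\mathbb{D}$ with $f(0)=0$ and $q=f'(0)$, $\operatorname{Re} q>0$, and let $G_r=(\mathrm{Id}+rf)^{-1}$, $r>0$, be its nonlinear resolvents. The net of functions $\{(1+rq)G_r(z)\}_{r>0}$ converges to $z$ as $r\to\infty$, uniformly on compact subsets of the unit disk $\mathbb{D}$.
   Context: $\mathbb{D}=\{z\in\mathbb{C}:|z|<1\}$. A holomorphic function $f:\mathbb{D}\to\mathbb{C}$ is called a generator if for every $z\in\mathbb{D}$ the Cauchy problem $\frac{\partial u(t,z)}{\partial t}+f(u(t,z))=0$, $u(0,z)=z$, has a unique solution $u(t,z)\in\mathbb{D}$ defined for all $t\ge 0$. For a generator $f$ and $r>0$, it is known that $(\mathrm{Id}+rf)(\mathbb{D})\supset\mathbb{D}$ and that $G_r:=(\mathrm{Id}+rf)^{-1}$ is a well-defined holomorphic self-mapping of $\mathbb{D}$ (that is, $G_r(w)$ is the unique $z\in\mathbb{D}$ with $z+rf(z)=w$); it is called the nonlinear resolvent of $f$. *)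

theory Defs
  imports "HOL-Complex_Analysis.Complex_Analysis"
begin

abbreviation unit_disc :: "complex set" where
  "unit_disc \<equiv> ball 0 1"

(* Global forward solution in the disc of u' + f(u) = 0, u(0) = z.  Values of u at negative
   times are irrelevant; the derivative at t = 0 is one-sided. *)
definition cauchy_solution :: "(complex \<Rightarrow> complex) \<Rightarrow> complex \<Rightarrow> (real \<Rightarrow> complex) \<Rightarrow> bool" where
  "cauchy_solution f z u \<longleftrightarrow>
     u 0 = z \<and>
     (\<forall>t\<ge>0. u t \<in> unit_disc \<and> (u has_vector_derivative - f (u t)) (at t within {0..}))"

(* Uniqueness means agreement at all times t >= 0, since u is a total function on the reals. *)
definition generator :: "(complex \<Rightarrow> complex) \<Rightarrow> bool" where
  "generator f \<longleftrightarrow>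
     f holomorphic_on unit_disc \<and>
     (\<forall>z\<in>unit_disc.
        (\<exists>u. cauchy_solution f z u) \<and>
        (\<forall>u v. cauchy_solution f z u \<longrightarrow> cauchy_solution f z v \<longrightarrow> (\<forall>t\<ge>0. u t = v t)))"

(* nonlinear_resolvent f r w is THE z in the disc with z + r f(z) = w.  The definition is
   meaningful when f is a generator, r > 0 and w lies in the disc. *)
definition nonlinear_resolvent :: "(complex \<Rightarrow> complex) \<Rightarrow> real \<Rightarrow> complex \<Rightarrow> complex" where
  "nonlinear_resolvent f r = the_inv_into unit_disc (\<lambda>z. z + of_real r * f z)"

end

theory Submission
  imports Defs
begin

text \<open>
  Since \<open>f 0 = 0\<close>, one can write \<open>f z = z * p z\<close> with \<open>p\<close> holomorphic and \<open>p 0 = q\<close>, and the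
  whole theorem follows from \<open>Re p > 0\<close> on the disc.  Indeed the resolvent equation
  \<open>z + r * f z = w\<close> then reads \<open>z = w / (1 + r * p z)\<close>.  On \<open>cball 0 \<rho>\<close> with \<open>\<rho> < 1\<close>
  the real part of \<open>p\<close> has a positive lower bound \<open>c\<close> and \<open>p\<close> is Lipschitz with some constant \<open>M\<close>.
  For large \<open>r\<close> the right-hand side is therefore a contraction of that ball, its fixed point
  is the resolvent, and it satisfies \<open>norm z \<le> 1 / (r * c)\<close>.  From
  \<open>(1 + r * q) * z - w = r * z * (q - p z)\<close> one reads off the error bound \<open>M / (c\<^sup>2 * r)\<close>, which is
  uniform in \<open>w\<close> (lemma \<open>resolvent_rescaled_error\<close>).

  That \<open>Re p > 0\<close> is where the flow enters.  For a fixed time \<open>t\<close> the map \<open>z \<mapsto> u(t, z)\<close> is a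
  holomorphic self-map of the disc which fixes \<open>0\<close>, so \<open>norm (u(t, z)) \<le> norm z\<close> by the Schwarz lemma.
  Comparing derivatives at \<open>t = 0\<close> gives \<open>z \<bullet> f z \<ge> 0\<close>, which is \<open>Re p \<ge> 0\<close> because
  \<open>z \<bullet> f z = (norm z)\<^sup>2 * Re (p z)\<close>; the minimum principle and \<open>Re q > 0\<close> make the inequality strict
  (lemma \<open>generator_factor\<close>).  The holomorphic dependence of the flow on its
  initial value is proved by comparing the difference of two nearby
  solutions with the solution of the linearized equation (lemma \<open>flow_field_differentiable\<close>).
\<close>

section \<open>Growth estimates for differential equations\<close>

text \<open>
  Gronwall's inequality in differential form: the bound on \<open>w'\<close> makes the function
  \<open>(norm (w s))\<^sup>2 * exp (- 2 * L * s)\<close> nonincreasing.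
\<close>

lemma gronwall_norm_le:
  fixes w w' :: "real \<Rightarrow> 'a::real_inner"
  assumes "0 \<le> t"
    and w: "\<And>s. s \<in> {0..t} \<Longrightarrow> (w has_vector_derivative w' s) (at s within {0..t})"
    and bound: "\<And>s. s \<in> {0..t} \<Longrightarrow> norm (w' s) \<le> L * norm (w s)"
  shows "norm (w t) \<le> exp (L * t) * norm (w 0)"
proof -
  define g where "g = (\<lambda>s. (w s \<bullet> w s) * exp (- 2 * L * s))"
  have cont: "continuous_on {0..t} w"
    using w by (meson continuous_on_eq_continuous_within has_vector_derivative_continuous)
  have "g t \<le> g 0"
  proof (rule DERIV_nonpos_imp_decreasing_open[OF \<open>0 \<le> t\<close>])
    show "continuous_on {0..t} g"
      unfolding g_def by (intro continuous_intros cont)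
  next
    fix s assume s: "0 < s" "s < t"
    have "(w has_vector_derivative w' s) (at s)"
      using w[of s] s by (simp add: at_within_Icc_at)
    then have dw: "(w has_derivative (\<lambda>h. h *\<^sub>R w' s)) (at s)"
      by (simp add: has_vector_derivative_def)
    have "((\<lambda>s. w s \<bullet> w s) has_derivative (\<lambda>h. w s \<bullet> (h *\<^sub>R w' s) + (h *\<^sub>R w' s) \<bullet> w s)) (at s)"
      by (rule has_derivative_inner[OF dw dw])
    then have di: "((\<lambda>s. w s \<bullet> w s) has_real_derivative 2 * (w s \<bullet> w' s)) (at s)"
      by (rule has_derivative_imp_has_field_derivative) (simp add: inner_commute)
    have dg: "(g has_real_derivative
        (2 * (w s \<bullet> w' s) - 2 * L * (w s \<bullet> w s)) * exp (- 2 * L * s)) (at s)"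
      unfolding g_def
      by (rule derivative_eq_intros di refl)+ (simp add: algebra_simps)
    have "w s \<bullet> w' s \<le> norm (w s) * norm (w' s)"
      by (rule norm_cauchy_schwarz)
    also have "\<dots> \<le> norm (w s) * (L * norm (w s))"
      using bound[of s] s by (intro mult_left_mono) auto
    finally have "w s \<bullet> w' s \<le> L * (w s \<bullet> w s)"
      by (simp add: dot_square_norm power2_eq_square algebra_simps)
    then have "(2 * (w s \<bullet> w' s) - 2 * L * (w s \<bullet> w s)) * exp (- 2 * L * s) \<le> 0"
      by (intro mult_nonpos_nonneg) auto
    with dg show "\<exists>y. (g has_real_derivative y) (at s) \<and> y \<le> 0"
      by blast
  qed
  then have "(norm (w t))\<^sup>2 * exp (- 2 * L * t) \<le> (norm (w 0))\<^sup>2"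
    by (simp add: g_def dot_square_norm)
  then have "(norm (w t))\<^sup>2 * exp (- 2 * L * t) * exp (2 * L * t) \<le> (norm (w 0))\<^sup>2 * exp (2 * L * t)"
    by (intro mult_right_mono) auto
  moreover have "exp (- 2 * L * t) * exp (2 * L * t) = (1::real)"
    by (simp flip: exp_add)
  moreover have "exp (2 * L * t) = (exp (L * t))\<^sup>2"
    by (simp add: power2_eq_square flip: exp_add)
  ultimately have "(norm (w t))\<^sup>2 \<le> (exp (L * t) * norm (w 0))\<^sup>2"
    by (metis (no_types, lifting) mult.assoc mult.commute mult.right_neutral power_mult_distrib)
  then show ?thesis
    by (rule power2_le_imp_le) simp
qed

text \<open>
  The Lipschitz bound on \<open>f\<close> is only available on \<open>C\<close>, and that the perturbed solution \<open>u\<close> remains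
  in \<open>C\<close> is part of the conclusion.  A continuity argument resolves the circularity: until the two
  solutions are \<open>\<epsilon>\<close> apart, \<open>u\<close> is in \<open>C\<close> and Gronwall's inequality holds, and that inequality
  keeps the distance below \<open>\<epsilon>\<close>.
\<close>

lemma solutions_stay_close:
  fixes f :: "complex \<Rightarrow> complex"
  assumes u0: "\<And>s. s \<in> {0..T} \<Longrightarrow> (u0 has_vector_derivative - f (u0 s)) (at s within {0..T})"
    and u: "\<And>s. s \<in> {0..T} \<Longrightarrow> (u has_vector_derivative - f (u s)) (at s within {0..T})"
    and lip: "\<And>a b. a \<in> C \<Longrightarrow> b \<in> C \<Longrightarrow> norm (f a - f b) \<le> L * norm (a - b)"
    and "0 \<le> L"
    and C: "\<And>s. s \<in> {0..T} \<Longrightarrow> cball (u0 s) \<epsilon> \<subseteq> C"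
    and small: "exp (L * T) * norm (u 0 - u0 0) < \<epsilon>"
    and t: "t \<in> {0..T}"
  shows "norm (u t - u0 t) \<le> exp (L * t) * norm (u 0 - u0 0)" and "u t \<in> C"
proof -
  define w where "w = (\<lambda>s. u s - u0 s)"
  have w: "(w has_vector_derivative - (f (u s) - f (u0 s))) (at s within {0..T})"
    if "s \<in> {0..T}" for s
    unfolding w_def using has_vector_derivative_diff[OF u[OF that] u0[OF that]] by simp
  have cont: "continuous_on {0..T} w"
    using w by (meson continuous_on_eq_continuous_within has_vector_derivative_continuous)
  have "0 < \<epsilon>"
    using small by (smt (verit) exp_ge_zero mult_nonneg_nonneg norm_ge_zero)
  have gron: "norm (w s) \<le> exp (L * s) * norm (w 0)"
    if s: "s \<in> {0..T}" and le: "\<And>r. r \<in> {0..s} \<Longrightarrow> norm (w r) \<le> \<epsilon>" for s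
  proof (rule gronwall_norm_le[where w' = "\<lambda>r. - (f (u r) - f (u0 r))"])
    show "0 \<le> s" using s by simp
  next
    fix r assume r: "r \<in> {0..s}"
    show "(w has_vector_derivative - (f (u r) - f (u0 r))) (at r within {0..s})"
      using r s by (intro has_vector_derivative_within_subset[OF w]) auto
    have "u r \<in> cball (u0 r) \<epsilon>" "u0 r \<in> cball (u0 r) \<epsilon>"
      using le[OF r] \<open>0 < \<epsilon>\<close> by (auto simp: w_def dist_norm norm_minus_commute)
    then show "norm (- (f (u r) - f (u0 r))) \<le> L * norm (w r)"
      using lip[of "u r" "u0 r"] C[of r] r s unfolding w_def
      by (smt (verit) atLeastAtMost_iff norm_minus_cancel subsetD)
  qed
  have lt: "norm (w s) < \<epsilon>" if s: "s \<in> {0..T}" for s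
  proof (rule ccontr)
    assume "\<not> norm (w s) < \<epsilon>"
    define S where "S = {0..T} \<inter> (\<lambda>r. norm (w r)) -` {\<epsilon>..}"
    have "closed S"
      unfolding S_def
      by (intro continuous_closed_preimage continuous_on_norm cont) auto
    moreover have "S \<noteq> {}" "bdd_below S"
      using s \<open>\<not> norm (w s) < \<epsilon>\<close> by (auto simp: S_def bdd_below_def)
    ultimately have Inf: "Inf S \<in> S"
      by (simp add: closed_contains_Inf)
    define t1 where "t1 = Inf S"
    have t1: "t1 \<in> {0..T}" "\<epsilon> \<le> norm (w t1)"
      using Inf by (auto simp: S_def t1_def)
    have below: "norm (w r) < \<epsilon>" if "r \<in> {0..<t1}" for r
    proof (rule ccontr)
      assume "\<not> norm (w r) < \<epsilon>"
      then have "r \<in> S" using that t1 by (auto simp: S_def)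
      then have "t1 \<le> r" unfolding t1_def by (intro cInf_lower \<open>bdd_below S\<close>)
      with that show False by simp
    qed
    have "norm (w 0) < \<epsilon>"
    proof -
      have "1 * norm (w 0) \<le> exp (L * T) * norm (w 0)"
        using \<open>0 \<le> L\<close> s by (intro mult_right_mono) auto
      with small show ?thesis by (simp add: w_def)
    qed
    with t1 have "0 < t1" by (cases "t1 = 0") auto
    \<comment> \<open>At the first time when the difference reaches \<open>\<epsilon>\<close> it equals \<open>\<epsilon>\<close>, so the tube estimate still covers it.\<close>
    have "norm (w t1) \<le> \<epsilon>"
    proof (rule continuous_le_on_closure[where S = "{0..<t1}" and f = "\<lambda>r. norm (w r)"])
      show "continuous_on (closure {0..<t1}) (\<lambda>r. norm (w r))"
        using t1 \<open>0 < t1\<close> by (intro continuous_on_norm continuous_on_subset[OF cont]) auto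
    qed (use below \<open>0 < t1\<close> in \<open>auto intro: less_imp_le\<close>)
    then have "norm (w t1) \<le> exp (L * t1) * norm (w 0)"
      using below t1 by (intro gron) (force simp: less_eq_real_def)+
    also have "\<dots> \<le> exp (L * T) * norm (w 0)"
      using \<open>0 \<le> L\<close> t1 by (intro mult_right_mono) (auto intro: mult_left_mono)
    also have "\<dots> < \<epsilon>"
      using small by (simp add: w_def)
    finally show False using t1 by simp
  qed
  show "norm (u t - u0 t) \<le> exp (L * t) * norm (u 0 - u0 0)"
    using gron[OF t] lt t by (force simp: w_def less_eq_real_def)
  show "u t \<in> C"
    using lt[OF t] C[OF t] by (auto simp: w_def dist_norm norm_minus_commute subset_iff)
qed

section \<open>Holomorphic dependence on the initial value\<close>

lemma holomorphic_lipschitz_quadratic: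
  fixes f :: "complex \<Rightarrow> complex"
  assumes f: "f holomorphic_on A" and "open A" and "compact C" "convex C" "C \<subseteq> A"
  obtains L M where "0 < L" "0 < M"
    and "\<And>a b. a \<in> C \<Longrightarrow> b \<in> C \<Longrightarrow> norm (f a - f b) \<le> L * norm (a - b)"
    and "\<And>a b. a \<in> C \<Longrightarrow> b \<in> C \<Longrightarrow>
           norm (f a - f b - deriv f b * (a - b)) \<le> M * (norm (a - b))\<^sup>2"
proof -
  have f': "deriv f holomorphic_on A"
    by (rule holomorphic_deriv[OF f \<open>open A\<close>])
  have f'': "deriv (deriv f) holomorphic_on A"
    by (rule holomorphic_deriv[OF f' \<open>open A\<close>])
  have bd: "\<exists>B>0. \<forall>z\<in>C. norm (g z) \<le> B" if "g holomorphic_on A" for g :: "complex \<Rightarrow> complex"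
  proof -
    have "continuous_on C g"
      using that \<open>C \<subseteq> A\<close> holomorphic_on_imp_continuous_on continuous_on_subset by blast
    then have "bounded (g ` C)"
      using \<open>compact C\<close> by (simp add: compact_continuous_image compact_imp_bounded)
    then show ?thesis by (auto simp: bounded_pos)
  qed
  obtain L where L: "0 < L" "\<And>z. z \<in> C \<Longrightarrow> norm (deriv f z) \<le> L" using bd[OF f'] by blast
  obtain M where M: "0 < M" "\<And>z. z \<in> C \<Longrightarrow> norm (deriv (deriv f) z) \<le> M" using bd[OF f''] by blast
  have der: "(g has_field_derivative deriv g z) (at z within C)"
    if "g holomorphic_on A" "z \<in> C" for g z
    using that \<open>open A\<close> \<open>C \<subseteq> A\<close> by (meson has_field_derivative_at_within holomorphic_derivI subsetD)
  show thesis
  proof (rule that[OF L(1) M(1)])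
    fix a b assume ab: "a \<in> C" "b \<in> C"
    show "norm (f a - f b) \<le> L * norm (a - b)"
      by (rule field_differentiable_bound[OF \<open>convex C\<close> der[OF f] L(2) ab])
    define F where "F = (\<lambda>n. (deriv ^^ n) f)"
    have F: "F 0 = f" "F (Suc 0) = deriv f" "F (Suc (Suc 0)) = deriv (deriv f)"
      by (simp_all add: F_def)
    have "norm (F 0 a - (\<Sum>i\<le>1. F i b * (a - b) ^ i / fact i)) \<le> M * norm (a - b) ^ Suc 1 / fact 1"
    proof (rule complex_Taylor[OF \<open>convex C\<close> _ _ ab(2,1)])
      fix i :: nat and x assume "x \<in> C" "i \<le> 1"
      then consider "i = 0" | "i = Suc 0" by linarith
      then show "(F i has_field_derivative F (Suc i) x) (at x within C)"
        by cases (use der[OF f \<open>x \<in> C\<close>] der[OF f' \<open>x \<in> C\<close>] in \<open>simp_all add: F\<close>)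
    qed (use M(2) in \<open>simp add: F\<close>)
    then show "norm (f a - f b - deriv f b * (a - b)) \<le> M * (norm (a - b))\<^sup>2"
      by (simp add: F power2_eq_square algebra_simps)
  qed
qed

lemma cauchy_solutionD:
  assumes "cauchy_solution f z u" and "t \<in> {0..T}"
  shows "(u has_vector_derivative - f (u t)) (at t within {0..T})"
  using assms unfolding cauchy_solution_def
  by (auto intro: has_vector_derivative_within_subset)

text \<open>
  Let \<open>u\<close> and \<open>u0\<close> be the solutions from \<open>z\<close> and \<open>z0\<close>.  Their difference nearly solves the linear equation
  \<open>v' = - f'(u0) * v\<close>.  With the integrating factor \<open>E\<close> of that equation, the product
  \<open>y = (u - u0) * E\<close> starts at \<open>z - z0\<close> and has a derivative of order \<open>(norm (z - z0))\<^sup>2\<close>, because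
  the linear terms cancel.  Hence \<open>y T = (z - z0) + O((norm (z - z0))\<^sup>2)\<close>, and the difference
  quotient at time \<open>T\<close> tends to \<open>1 / E T\<close>.
\<close>

lemma flow_field_differentiable:
  assumes f: "f holomorphic_on unit_disc"
    and U: "\<And>z. z \<in> unit_disc \<Longrightarrow> cauchy_solution f z (U z)"
    and z0: "z0 \<in> unit_disc" and "0 < T"
  shows "(\<lambda>z. U z T) field_differentiable (at z0)"
proof -
  define u0 where "u0 = U z0"
  have u0: "(u0 has_vector_derivative - f (u0 s)) (at s within {0..T})" if "s \<in> {0..T}" for s
    using cauchy_solutionD[OF U[OF z0] that] by (simp add: u0_def)
  have u0_disc: "u0 s \<in> unit_disc" if "s \<in> {0..T}" for s
    using U[OF z0] that by (simp add: cauchy_solution_def u0_def)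
  have U0: "U z 0 = z" if "z \<in> unit_disc" for z
    using U[OF that] by (simp add: cauchy_solution_def)
  have cont_u0: "continuous_on {0..T} u0"
    using u0 by (meson continuous_on_eq_continuous_within has_vector_derivative_continuous)
  obtain s0 where s0: "s0 \<in> {0..T}" "\<And>s. s \<in> {0..T} \<Longrightarrow> norm (u0 s) \<le> norm (u0 s0)"
    using continuous_attains_sup[OF compact_Icc _ continuous_on_norm[OF cont_u0]] \<open>0 < T\<close>
    by (metis atLeastatMost_empty_iff less_imp_le)
  \<comment> \<open>\<open>\<epsilon>\<close> is half the distance of the orbit of \<open>z0\<close> up to time \<open>T\<close> from the unit circle, so the closed
      \<open>\<epsilon>\<close>-tube around the orbit lies in a closed ball inside the disc.\<close>
  define \<epsilon> where "\<epsilon> = (1 - norm (u0 s0)) / 2"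
  define C where "C = cball (0::complex) (norm (u0 s0) + \<epsilon>)"
  have "0 < \<epsilon>" using u0_disc[OF s0(1)] by (simp add: \<epsilon>_def)
  have C: "compact C" "convex C" "C \<subseteq> unit_disc"
    using \<open>0 < \<epsilon>\<close> by (auto simp: C_def \<epsilon>_def field_simps)
  have tube: "cball (u0 s) \<epsilon> \<subseteq> C" if "s \<in> {0..T}" for s
    unfolding C_def using s0(2)[OF that] by (simp add: cball_subset_cball_iff dist_norm)
  obtain L M where "0 < L" "0 < M"
    and lip: "\<And>a b. a \<in> C \<Longrightarrow> b \<in> C \<Longrightarrow> norm (f a - f b) \<le> L * norm (a - b)"
    and quad: "\<And>a b. a \<in> C \<Longrightarrow> b \<in> C \<Longrightarrow>
           norm (f a - f b - deriv f b * (a - b)) \<le> M * (norm (a - b))\<^sup>2"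
    using holomorphic_lipschitz_quadratic[OF f _ C] by auto
  have "continuous_on {0..T} (\<lambda>s. deriv f (u0 s))"
    using continuous_on_compose2[OF holomorphic_on_imp_continuous_on[OF holomorphic_deriv[OF f]] cont_u0]
      u0_disc by blast
  then obtain A where A: "\<And>s. s \<in> {0..T} \<Longrightarrow>
      (A has_vector_derivative deriv f (u0 s)) (at s within {0..T})"
    by (rule antiderivative_continuous) blast
  define E where "E = (\<lambda>s. exp (A s - A 0))"
  have E: "(E has_vector_derivative deriv f (u0 s) * E s) (at s within {0..T})"
    if "s \<in> {0..T}" for s
  proof -
    have "((\<lambda>s. A s - A 0) has_vector_derivative deriv f (u0 s)) (at s within {0..T})"
      using has_vector_derivative_diff[OF A[OF that] has_vector_derivative_const[of "A 0"]] by simp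
    from field_vector_diff_chain_within[OF this DERIV_subset[OF DERIV_exp subset_UNIV]]
    show ?thesis by (simp add: E_def o_def)
  qed
  have cont_E: "continuous_on {0..T} E"
    using E by (meson continuous_on_eq_continuous_within has_vector_derivative_continuous)
  then have "bounded (E ` {0..T})"
    by (simp add: compact_continuous_image compact_imp_bounded)
  then obtain N where N: "0 < N" "\<And>s. s \<in> {0..T} \<Longrightarrow> norm (E s) \<le> N"
    by (auto simp: bounded_pos)
  define D where "D = 1 / E T"
  define K where "K = N * (M * (exp (L * T))\<^sup>2) * T"
  have "0 < K" using N \<open>0 < M\<close> \<open>0 < T\<close> by (simp add: K_def)
  have quotient: "norm ((U z T - U z0 T) / (z - z0) - D) \<le> norm D * K * norm (z - z0)"
    if z: "z \<in> unit_disc" "z \<noteq> z0" and small: "exp (L * T) * norm (z - z0) < \<epsilon>" for z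
  proof -
    define u where "u = U z"
    have u: "(u has_vector_derivative - f (u s)) (at s within {0..T})" if "s \<in> {0..T}" for s
      using cauchy_solutionD[OF U[OF z(1)] that] by (simp add: u_def)
    have init: "u 0 - u0 0 = z - z0"
      using U0 z z0 by (simp add: u_def u0_def)
    have close: "norm (u s - u0 s) \<le> exp (L * T) * norm (z - z0)" "u s \<in> C"
      if s: "s \<in> {0..T}" for s
    proof -
      note * = solutions_stay_close[OF u0 u lip less_imp_le[OF \<open>0 < L\<close>] tube _ s, unfolded init, OF _ _ _ _ _ small]
      have "norm (u s - u0 s) \<le> exp (L * s) * norm (z - z0)" using * by blast
      also have "\<dots> \<le> exp (L * T) * norm (z - z0)"
        using s \<open>0 < L\<close> by (intro mult_right_mono) auto
      finally show "norm (u s - u0 s) \<le> exp (L * T) * norm (z - z0)" .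
      show "u s \<in> C" using * by blast
    qed
    define y where "y = (\<lambda>s. (u s - u0 s) * E s)"
    define y' where "y' = (\<lambda>s. - (f (u s) - f (u0 s) - deriv f (u0 s) * (u s - u0 s)) * E s)"
    have y: "(y has_vector_derivative y' s) (at s within {0..T})" if "s \<in> {0..T}" for s
      unfolding y_def y'_def
      using has_vector_derivative_mult[OF has_vector_derivative_diff[OF u[OF that] u0[OF that]] E[OF that]]
      by (simp add: algebra_simps)
    have y'_bound: "norm (y' s) \<le> N * (M * (exp (L * T))\<^sup>2) * (norm (z - z0))\<^sup>2" if s: "s \<in> {0..T}" for s
    proof -
      have "u0 s \<in> C" using tube[OF s] \<open>0 < \<epsilon>\<close> by auto
      have "norm (y' s) = norm (f (u s) - f (u0 s) - deriv f (u0 s) * (u s - u0 s)) * norm (E s)"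
        by (simp add: y'_def norm_mult norm_minus_commute)
      also have "\<dots> \<le> (M * (norm (u s - u0 s))\<^sup>2) * N"
        using quad[OF close(2)[OF s] \<open>u0 s \<in> C\<close>] N(2)[OF s] \<open>0 < M\<close>
        by (intro mult_mono) auto
      also have "\<dots> \<le> (M * (exp (L * T) * norm (z - z0))\<^sup>2) * N"
        using close(1)[OF s] \<open>0 < M\<close> \<open>0 < N\<close>
        by (intro mult_right_mono mult_left_mono power_mono) auto
      finally show ?thesis by (simp add: power_mult_distrib algebra_simps)
    qed
    have "norm (y T - y 0) \<le>
        N * (M * (exp (L * T))\<^sup>2) * (norm (z - z0))\<^sup>2 * T - N * (M * (exp (L * T))\<^sup>2) * (norm (z - z0))\<^sup>2 * 0"
    proof (rule differentiable_bound_general[OF \<open>0 < T\<close>, where f' = y'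
          and \<phi>' = "\<lambda>_. N * (M * (exp (L * T))\<^sup>2) * (norm (z - z0))\<^sup>2"])
      show "continuous_on {0..T} y"
        using y by (meson continuous_on_eq_continuous_within has_vector_derivative_continuous)
      show "(y has_vector_derivative y' s) (at s)" if "0 < s" "s < T" for s
        using y[of s] that by (simp add: at_within_Icc_at)
      show "norm (y' s) \<le> N * (M * (exp (L * T))\<^sup>2) * (norm (z - z0))\<^sup>2" if "0 < s" "s < T" for s
        using y'_bound[of s] that by simp
    qed (auto intro!: continuous_intros derivative_eq_intros
              simp flip: has_real_derivative_iff_has_vector_derivative)
    moreover have "y 0 = z - z0" by (simp add: y_def E_def init)
    ultimately have bound: "norm (y T - (z - z0)) \<le> K * (norm (z - z0))\<^sup>2"
      by (simp add: K_def algebra_simps)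
    have "E T \<noteq> 0" by (simp add: E_def)
    then have "(u T - u0 T) / (z - z0) - D = D * (y T - (z - z0)) / (z - z0)"
      using z(2) by (simp add: y_def D_def field_simps)
    then have "norm ((u T - u0 T) / (z - z0) - D) = norm D * norm (y T - (z - z0)) / norm (z - z0)"
      by (simp add: norm_mult norm_divide)
    also have "\<dots> \<le> norm D * (K * (norm (z - z0))\<^sup>2) / norm (z - z0)"
      using bound by (intro divide_right_mono mult_left_mono) auto
    also have "\<dots> = norm D * K * norm (z - z0)"
      using z(2) by (simp add: power2_eq_square)
    finally show ?thesis by (simp add: u_def u0_def)
  qed
  have "((\<lambda>z. (U z T - U z0 T) / (z - z0)) \<longlongrightarrow> D) (at z0)"
  proof (rule LIM_zero_cancel, rule Lim_null_comparison)
    have "((\<lambda>z. exp (L * T) * norm (z - z0)) \<longlongrightarrow> exp (L * T) * norm (z0 - z0)) (at z0)"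
      by (intro tendsto_intros)
    then have "\<forall>\<^sub>F z in at z0. exp (L * T) * norm (z - z0) < \<epsilon>"
      by (rule order_tendstoD) (use \<open>0 < \<epsilon>\<close> in simp)
    moreover have "\<forall>\<^sub>F z in at z0. z \<in> unit_disc \<and> z \<noteq> z0"
      using z0 by (intro eventually_conj eventually_at_in_open' eventually_neq_at_within) auto
    ultimately show "\<forall>\<^sub>F z in at z0. norm ((U z T - U z0 T) / (z - z0) - D) \<le> norm D * K * norm (z - z0)"
      by eventually_elim (use quotient in blast)
    have "((\<lambda>z. norm D * K * norm (z - z0)) \<longlongrightarrow> norm D * K * norm (z0 - z0)) (at z0)"
      by (intro tendsto_intros)
    then show "((\<lambda>z. norm D * K * norm (z - z0)) \<longlongrightarrow> 0) (at z0)" by simp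
  qed
  then show ?thesis
    unfolding field_differentiable_def has_field_derivative_iff by blast
qed

section \<open>Generators that vanish at the origin\<close>

text \<open>
  The time-\<open>t\<close> map of the flow is a holomorphic self-map of the disc.  It fixes \<open>0\<close>,
  because the constant \<open>0\<close> is the solution from \<open>0\<close>, so the Schwarz lemma applies to it.
\<close>

lemma cauchy_solution_norm_le:
  assumes "generator f" and "f 0 = 0" and u: "cauchy_solution f z u" and z: "z \<in> unit_disc" and "0 < t"
  shows "norm (u t) \<le> norm z"
proof -
  have uniq: "v t = w t" if "y \<in> unit_disc" "cauchy_solution f y v" "cauchy_solution f y w" for y v w
    using assms(1) that \<open>0 < t\<close> unfolding generator_def by (meson less_imp_le)
  have "\<forall>y\<in>unit_disc. \<exists>v. cauchy_solution f y v"
    using assms(1) unfolding generator_def by blast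
  then obtain U where U: "\<And>y. y \<in> unit_disc \<Longrightarrow> cauchy_solution f y (U y)"
    by metis
  define \<phi> where "\<phi> = (\<lambda>y. U y t)"
  have "f holomorphic_on unit_disc" using assms(1) by (simp add: generator_def)
  then have "\<phi> holomorphic_on unit_disc"
    using flow_field_differentiable[OF _ U _ \<open>0 < t\<close>]
    by (auto simp: \<phi>_def holomorphic_on_def intro: field_differentiable_at_within)
  moreover have "\<phi> 0 = 0"
  proof -
    have "cauchy_solution f 0 (\<lambda>_. 0)"
      using \<open>f 0 = 0\<close> by (simp add: cauchy_solution_def)
    then show ?thesis
      unfolding \<phi>_def using U[of 0] uniq[of 0] by simp
  qed
  moreover have "norm (\<phi> y) < 1" if "norm y < 1" for y
    using U[of y] that \<open>0 < t\<close> by (auto simp: \<phi>_def cauchy_solution_def)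
  ultimately have "norm (\<phi> z) \<le> norm z"
    using Schwarz_Lemma(1)[of \<phi> z] z by simp
  then show ?thesis
    using uniq[OF z U[OF z] u] by (simp add: \<phi>_def)
qed

text \<open>
  If \<open>z \<bullet> f z\<close> were negative, \<open>(norm (u t))\<^sup>2\<close> would have the positive derivative
  \<open>- 2 * (z \<bullet> f z)\<close> at \<open>t = 0\<close>, so the solution would move away from the origin.
\<close>

lemma generator_inner_nonneg:
  assumes "generator f" and "f 0 = 0" and z: "z \<in> unit_disc"
  shows "0 \<le> z \<bullet> f z"
proof (rule ccontr)
  assume "\<not> 0 \<le> z \<bullet> f z"
  obtain u where u: "cauchy_solution f z u"
    using assms(1) z unfolding generator_def by blast
  then have "u 0 = z" and "(u has_vector_derivative - f (u 0)) (at 0 within {0..})"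
    by (auto simp: cauchy_solution_def)
  then have du: "(u has_derivative (\<lambda>h. h *\<^sub>R - f z)) (at 0 within {0..})"
    by (simp add: has_vector_derivative_def)
  have "((\<lambda>t. u t \<bullet> u t) has_real_derivative - 2 * (z \<bullet> f z)) (at 0 within {0..})"
    by (rule has_derivative_imp_has_field_derivative[OF has_derivative_inner[OF du du]])
       (simp add: \<open>u 0 = z\<close> inner_commute)
  then obtain d where d: "0 < d" "\<And>h. 0 < h \<Longrightarrow> h < d \<Longrightarrow> u 0 \<bullet> u 0 < u h \<bullet> u h"
    using has_real_derivative_pos_inc_right[of "\<lambda>t. u t \<bullet> u t" "- 2 * (z \<bullet> f z)" 0 "{0..}"]
      \<open>\<not> 0 \<le> z \<bullet> f z\<close> by auto
  then have "norm z < norm (u (d / 2))"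
    using d(2)[of "d / 2"] by (simp add: \<open>u 0 = z\<close> norm_lt)
  with cauchy_solution_norm_le[OF assms(1,2) u z, of "d / 2"] d(1) show False
    by simp
qed

text \<open>
  At a point where \<open>Re p\<close> vanishes, \<open>exp (- p)\<close> attains its maximal modulus \<open>1\<close>; it would then be
  constant, which contradicts \<open>Re (p a) > 0\<close>.
\<close>

lemma Re_pos_of_Re_nonneg:
  assumes p: "p holomorphic_on S" and S: "open S" "connected S"
    and nonneg: "\<And>z. z \<in> S \<Longrightarrow> 0 \<le> Re (p z)"
    and a: "a \<in> S" "0 < Re (p a)" and z: "z \<in> S"
  shows "0 < Re (p z)"
proof (rule ccontr)
  assume "\<not> 0 < Re (p z)"
  with nonneg[OF z] have "Re (p z) = 0" by simp
  have "(\<lambda>x. exp (- p x)) constant_on S"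
    by (rule maximum_modulus_principle[of _ S S z])
       (use assms \<open>Re (p z) = 0\<close> in \<open>auto intro!: holomorphic_intros\<close>)
  then have "norm (exp (- p a)) = norm (exp (- p z))"
    using a(1) z by (metis constant_on_def)
  with \<open>Re (p z) = 0\<close> a(2) show False by simp
qed

lemma generator_factor:
  assumes "generator f" and "f 0 = 0" and "0 < Re (deriv f 0)"
  obtains p where "p holomorphic_on unit_disc" "\<And>z. z \<in> unit_disc \<Longrightarrow> f z = z * p z"
    "p 0 = deriv f 0" "\<And>z. z \<in> unit_disc \<Longrightarrow> 0 < Re (p z)"
proof -
  have "f holomorphic_on unit_disc" using assms(1) by (simp add: generator_def)
  then obtain p where p: "p holomorphic_on unit_disc" "\<And>z. norm z < 1 \<Longrightarrow> f z = z * p z"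
    "deriv f 0 = p 0"
    using Schwarz3[of f 1] \<open>f 0 = 0\<close> by metis
  have nonneg: "0 \<le> Re (p z)" if z: "z \<in> unit_disc" for z
  proof (cases "z = 0")
    case True
    then show ?thesis using assms(3) p(3) by simp
  next
    case False
    have "z \<bullet> f z = (norm z)\<^sup>2 * Re (p z)"
      unfolding cmod_power2 inner_complex_def using p(2)[of z] z
      by (simp add: power2_eq_square algebra_simps)
    then show ?thesis
      using generator_inner_nonneg[OF assms(1,2) z] False
      by (simp add: zero_le_mult_iff)
  qed
  have "0 < Re (p z)" if "z \<in> unit_disc" for z
    by (rule Re_pos_of_Re_nonneg[OF p(1) _ _ nonneg, of 0])
       (use assms(3) p(3) that in auto)
  then show thesis
    using p that by auto
qed

section \<open>Resolvents for large parameters\<close>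

text \<open>
  A factorization \<open>f z = z * p z\<close> with \<open>p\<close> holomorphic and \<open>Re p > 0\<close> is all that enters here.  The quantitative form,
  with an error of order \<open>1 / r\<close> on each ball \<open>cball 0 \<rho>\<close> with \<open>\<rho> < 1\<close>, contains the uniform
  convergence.  For small \<open>r\<close> the map \<open>S\<close> in the proof may fail to be a contraction, so the threshold on
  \<open>r\<close> below is exactly the condition that its Lipschitz constant \<open>k\<close> be less than \<open>1\<close>.
\<close>

lemma resolvent_rescaled_error:
  fixes p :: "complex \<Rightarrow> complex"
  assumes p: "p holomorphic_on unit_disc" and pos: "\<And>z. z \<in> unit_disc \<Longrightarrow> 0 < Re (p z)"
    and f: "\<And>z. z \<in> unit_disc \<Longrightarrow> f z = z * p z"
    and "0 < \<rho>" "\<rho> < 1"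
  obtains K where "\<forall>\<^sub>F r in at_top. \<forall>w \<in> cball 0 \<rho>.
     norm ((1 + of_real r * p 0) * nonlinear_resolvent f r w - w) \<le> K / r"
proof -
  define B where "B = cball (0::complex) \<rho>"
  have B: "B \<subseteq> unit_disc" "compact B" "convex B" "0 \<in> B" "B \<noteq> {}"
    using \<open>0 < \<rho>\<close> \<open>\<rho> < 1\<close> by (auto simp: B_def)
  have contp: "continuous_on B p"
    using p B holomorphic_on_imp_continuous_on continuous_on_subset by blast
  obtain z0 where z0: "z0 \<in> B" "\<And>z. z \<in> B \<Longrightarrow> Re (p z0) \<le> Re (p z)"
    using continuous_attains_inf[of B "\<lambda>z. Re (p z)"] B contp
    by (auto intro: continuous_intros)
  define c where "c = Re (p z0)"
  have "0 < c" using z0 B pos by (auto simp: c_def)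
  have c: "c \<le> Re (p z)" if "z \<in> B" for z
    using z0 that by (simp add: c_def)
  have "continuous_on B (deriv p)"
    using holomorphic_deriv[OF p] B holomorphic_on_imp_continuous_on continuous_on_subset by blast
  then have "compact (deriv p ` B)"
    using B by (simp add: compact_continuous_image)
  then obtain M where M: "0 < M" "\<And>z. z \<in> B \<Longrightarrow> norm (deriv p z) \<le> M"
    using compact_imp_bounded bounded_pos by (metis imageI)
  have lip: "norm (p a - p b) \<le> M * norm (a - b)" if "a \<in> B" "b \<in> B" for a b
  proof (rule field_differentiable_bound[OF \<open>convex B\<close> _ M(2) that])
    fix z assume "z \<in> B"
    then show "(p has_field_derivative deriv p z) (at z within B)"
      using p B by (meson Elementary_Metric_Spaces.open_ball has_field_derivative_at_within holomorphic_derivI subsetD)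
  qed auto
  have den: "1 + r * Re (p z) \<le> norm (1 + of_real r * p z)" for r z
    using complex_Re_le_cmod[of "1 + of_real r * p z"] by simp
  have main: "norm ((1 + of_real r * p 0) * nonlinear_resolvent f r w - w) \<le> (M / c\<^sup>2) / r"
    if r: "r > M / c\<^sup>2" and w: "w \<in> B" for r w
  proof -
    have "0 < r" using r \<open>0 < M\<close> \<open>0 < c\<close> by (smt (verit) divide_pos_pos zero_less_power)
    \<comment> \<open>The growth of the denominator on \<open>B\<close>, linear in \<open>r\<close>, makes \<open>S\<close> contract there; the bound
        on the whole disc serves to rule out solutions outside \<open>B\<close>.\<close>
    have denB: "r * c < norm (1 + of_real r * p z)" if "z \<in> B" for z
      using den[of r z] mult_left_mono[OF c[OF that], of r] \<open>0 < r\<close> by linarith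
    have den1: "1 < norm (1 + of_real r * p z)" if "z \<in> unit_disc" for z
      using den[of r z] mult_pos_pos[OF \<open>0 < r\<close> pos[OF that]] by linarith
    define S where "S = (\<lambda>z. w / (1 + of_real r * p z))"
    have wle: "norm w \<le> \<rho>" using w by (simp add: B_def)
    have S_B: "S z \<in> B" if "z \<in> unit_disc" for z
    proof -
      have "norm (S z) \<le> norm w / 1"
        unfolding S_def norm_divide using den1[OF that] by (intro divide_left_mono) auto
      then show ?thesis using wle by (simp add: B_def)
    qed
    have equation: "z + of_real r * f z = w \<longleftrightarrow> S z = z" if "z \<in> unit_disc" for z
    proof -
      have "1 + of_real r * p z \<noteq> 0" using den1[OF that] by auto
      then show ?thesis
        by (auto simp: S_def f[OF that] field_simps)
    qed
    define k where "k = M / (r * c\<^sup>2)"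
    have "0 \<le> k" "k < 1"
      using r \<open>0 < r\<close> \<open>0 < M\<close> \<open>0 < c\<close> by (auto simp: k_def field_simps)
    have contraction: "dist (S a) (S b) \<le> k * dist a b" if ab: "a \<in> B" "b \<in> B" for a b
    proof -
      let ?A = "1 + of_real r * p a" and ?C = "1 + of_real r * p b"
      have nz: "?A \<noteq> 0" "?C \<noteq> 0" using den1[of a] den1[of b] ab B by auto
      have "S a - S b = w * (of_real r * (p b - p a)) / (?A * ?C)"
        using nz by (simp add: S_def field_simps)
      then have "norm (S a - S b) = norm w * (r * norm (p b - p a)) / (norm ?A * norm ?C)"
        using \<open>0 < r\<close> by (simp add: norm_mult norm_divide)
      also have "\<dots> \<le> 1 * (r * (M * norm (b - a))) / ((r * c) * (r * c))"
        using lip[OF ab(2,1)] wle \<open>\<rho> < 1\<close> denB ab \<open>0 < r\<close> \<open>0 < c\<close> \<open>0 < M\<close>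
        by (intro frac_le mult_mono) (auto intro: less_imp_le mult_pos_pos)
      also have "\<dots> = k * norm (a - b)"
        using \<open>0 < r\<close> \<open>0 < c\<close> by (simp add: k_def field_simps power2_eq_square norm_minus_commute)
      finally show ?thesis by (simp add: dist_norm)
    qed
    have "\<exists>!z. z \<in> B \<and> S z = z"
      by (rule Banach_fix[OF compact_imp_complete[OF \<open>compact B\<close>] \<open>B \<noteq> {}\<close> \<open>0 \<le> k\<close> \<open>k < 1\<close>])
         (use contraction S_B B in auto)
    then obtain z where z: "z \<in> B" "S z = z" and uniq: "\<And>y. y \<in> B \<Longrightarrow> S y = y \<Longrightarrow> y = z"
      by blast
    \<comment> \<open>Every solution in the whole disc lies in \<open>B\<close>, because \<open>S\<close> maps the disc into \<open>B\<close>.\<close>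
    have "nonlinear_resolvent f r w = z"
      unfolding nonlinear_resolvent_def the_inv_into_def
    proof (rule the_equality)
      show "z \<in> unit_disc \<and> z + of_real r * f z = w"
        using z B equation by auto
    next
      fix y assume y: "y \<in> unit_disc \<and> y + of_real r * f y = w"
      then have "S y = y" using equation by blast
      moreover from this have "y \<in> B" using S_B y by metis
      ultimately show "y = z" using uniq by blast
    qed
    moreover have "norm ((1 + of_real r * p 0) * z - w) \<le> (M / c\<^sup>2) / r"
    proof -
      have zeq: "z * (1 + of_real r * p z) = w"
      proof -
        have "1 + of_real r * p z \<noteq> 0" using den1[of z] z B by auto
        then show ?thesis
          using z(2) by (metis S_def nonzero_eq_divide_eq)
      qed
      have small: "norm z \<le> 1 / (r * c)"
      proof -
        have "norm z * (r * c) \<le> norm z * norm (1 + of_real r * p z)"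
          using denB[OF z(1)] by (intro mult_left_mono) auto
        also have "\<dots> \<le> 1" using zeq wle \<open>\<rho> < 1\<close> by (simp flip: norm_mult)
        finally show ?thesis using \<open>0 < r\<close> \<open>0 < c\<close> by (simp add: field_simps)
      qed
      have "(1 + of_real r * p 0) * z - w = of_real r * z * (p 0 - p z)"
        by (subst zeq[symmetric]) (simp add: algebra_simps)
      then have "norm ((1 + of_real r * p 0) * z - w) = r * norm z * norm (p 0 - p z)"
        using \<open>0 < r\<close> by (simp add: norm_mult)
      also have "\<dots> \<le> r * norm z * (M * norm z)"
        using lip[OF \<open>0 \<in> B\<close> z(1)] \<open>0 < r\<close> by (intro mult_left_mono) auto
      also have "\<dots> = r * M * (norm z * norm z)" by simp
      also have "\<dots> \<le> r * M * ((1 / (r * c)) * (1 / (r * c)))"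
        using small \<open>0 < r\<close> \<open>0 < M\<close> \<open>0 < c\<close> by (intro mult_left_mono mult_mono) auto
      also have "\<dots> = (M / c\<^sup>2) / r"
        using \<open>0 < r\<close> \<open>0 < c\<close> by (simp add: field_simps power2_eq_square)
      finally show ?thesis .
    qed
    ultimately show ?thesis by simp
  qed
  show thesis
    by (rule that[of "M / c\<^sup>2"])
       (use main in \<open>auto simp: B_def intro!: eventually_mono[OF eventually_gt_at_top[of "M / c\<^sup>2"]]\<close>)
qed

section \<open>Convergence of the rescaled resolvents\<close>

theorem corollary4p2:
  fixes f :: "complex \<Rightarrow> complex" and q :: complex
  assumes "generator f"
    and "f 0 = 0"
    and "q = deriv f 0"
    and "Re q > 0"
  shows "\<forall>K. compact K \<and> K \<subseteq> unit_disc \<longrightarrow>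
           uniform_limit K (\<lambda>(r::real) z. (1 + of_real r * q) * nonlinear_resolvent f r z) (\<lambda>z. z) at_top"
proof (intro allI impI)
  fix K :: "complex set"
  assume K: "compact K \<and> K \<subseteq> unit_disc"
  obtain p where p: "p holomorphic_on unit_disc" "\<And>z. z \<in> unit_disc \<Longrightarrow> f z = z * p z"
    "p 0 = q" "\<And>z. z \<in> unit_disc \<Longrightarrow> 0 < Re (p z)"
    using generator_factor[OF assms(1,2)] assms(3,4) by metis
  obtain \<rho> where \<rho>: "0 < \<rho>" "\<rho> < 1" "K \<subseteq> cball 0 \<rho>"
  proof (cases "K = {}")
    case True
    then show ?thesis using that[of "1/2"] by simp
  next
    case False
    then obtain x where x: "x \<in> K" "\<And>y. y \<in> K \<Longrightarrow> norm y \<le> norm x"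
      using continuous_attains_sup[of K norm] K by (auto intro: continuous_intros)
    have "norm x < 1" using x(1) K by auto
    have "K \<subseteq> cball 0 ((norm x + 1) / 2)"
    proof
      fix y assume "y \<in> K"
      with x(2)[of y] \<open>norm x < 1\<close> show "y \<in> cball 0 ((norm x + 1) / 2)" by simp
    qed
    with \<open>norm x < 1\<close> show ?thesis
      by (intro that[of "(norm x + 1) / 2"]) (auto intro: add_nonneg_pos)
  qed
  obtain M where M: "\<forall>\<^sub>F r in at_top. \<forall>w \<in> cball 0 \<rho>.
     norm ((1 + of_real r * p 0) * nonlinear_resolvent f r w - w) \<le> M / r"
    using resolvent_rescaled_error[OF p(1,4,2) \<rho>(1,2)] by blast
  show "uniform_limit K (\<lambda>(r::real) z. (1 + of_real r * q) * nonlinear_resolvent f r z) (\<lambda>z. z) at_top"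
  proof (rule uniform_limitI)
    fix e :: real assume "0 < e"
    have "((\<lambda>r. M / r) \<longlongrightarrow> 0) at_top"
      by (rule tendsto_divide_0[OF tendsto_const filterlim_at_top_imp_at_infinity[OF filterlim_ident]])
    then have "\<forall>\<^sub>F r in at_top. M / r < e"
      by (rule order_tendstoD) fact
    with M show "\<forall>\<^sub>F r in at_top. \<forall>z\<in>K.
        dist ((1 + of_real r * q) * nonlinear_resolvent f r z) z < e"
    proof eventually_elim
      case (elim r)
      then show ?case using \<rho>(3) p(3) by (fastforce simp: dist_norm)
    qed
  qed
qed

end
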